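(* Let $s \in \mathbb{F}_q$ with $s \notin \{0, 1, -1\}$. The polynomial $g_s(y)$ has a zero in $\mathbb{F}_q$ if and only if $$\rho\Big(\frac{1+s}{2}\Big)=1 \quad\text{and}\quad \rho\Big(\frac{1-s}{2}\Big)=-1. \qquad ( * )$$ When $( * )$ holds, $(1+s)/2$ and $(1-s)/2$ are the only zeros of $g_s(y)$ in $\mathbb{F}_q$, and $g_s(y)$ has the irreducible factorization over $\mathbb{F}_q$ $$g_s(y)= \frac{\tau^2}{2} \Big(y-\frac{1+s}{2}\Big)\Big(y-\frac{1-s}{2}\Big) \prod_{a \in \mathcal{C}}\Big(y^2 + (2as-1-s)y +\frac{(2a-1-s)^2}{4} \Big),$$ i.e. this identity holds and each of the displayed linear and quadratic factors is irreducible over $\mathbb{F}_q$.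
   Context: $\mathbb{F}_q$ is a finite field with $q$ elements, $q$ a power of an odd prime; $n=(q+1)/2$; for $s\in\mathbb{F}_q$, $g_s(y) := y^n+(1-y)^n-s \in \mathbb{F}_q[y]$. $\rho$ is the quadratic character on $\mathbb{F}_q$ (with $\rho(0)=0$). $\tau = 1$ if $q\equiv 1 \pmod 4$ and $\tau = 2$ if $q \equiv 3 \pmod 4$. $\mathcal{C} := \{a \in \mathbb{F}_q : \rho(a)=\rho(1-a)=1\}$. *)

theory Defs
  imports "HOL-Computational_Algebra.Computational_Algebra" "HOL-Library.Cardinality"
begin

definition quad_char :: "'a::field \<Rightarrow> int" where
  "quad_char x = (if x = 0 then 0 else if \<exists>y. x = y ^ 2 then 1 else -1)"

text \<open>The field with \<open>q\<close> elements is the type \<open>'a\<close> itself, so \<open>q = CARD('a)\<close> and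
  \<open>n = (q + 1) / 2\<close>; the division is exact because \<open>q\<close> is odd wherever this is used.
  The polynomial \<open>[:0, 1:]\<close> is the variable \<open>y\<close> and \<open>[:1, -1:]\<close> is \<open>1 - y\<close>.\<close>
definition g_poly :: "'a::{field,finite} \<Rightarrow> 'a poly" where
  "g_poly s = (let n = (CARD('a) + 1) div 2 in [:0, 1:] ^ n + [:1, -1:] ^ n - [:s:])"

text \<open>Only meaningful for odd \<open>q\<close>, where the second case is \<open>q mod 4 = 3\<close>.\<close>
definition tau :: "nat \<Rightarrow> nat" where
  "tau q = (if q mod 4 = 1 then 1 else 2)"

definition C_set :: "'a::field set" where
  "C_set = {a. quad_char a = 1 \<and> quad_char (1 - a) = 1}"

definition quad_factor :: "'a::field \<Rightarrow> 'a \<Rightarrow> 'a poly" where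
  "quad_factor s a = [:(2 * a - 1 - s) ^ 2 / 4, 2 * a * s - 1 - s, 1:]"

end

theory Submission
  imports Defs "HOL-Number_Theory.Cong"
begin

text \<open>
  Let \<open>\<rho>\<close> be the quadratic character and \<open>n = (q + 1) / 2\<close>. Euler's criterion gives
  \<open>y\<^sup>n = y \<rho>(y)\<close> for every field element \<open>y\<close>, so \<open>y\<^sup>n + (1 - y)\<^sup>n\<close> equals \<open>\<plusminus> 1\<close> or
  \<open>\<plusminus> (2 y - 1)\<close>, depending on the signs \<open>\<rho>(y)\<close> and \<open>\<rho>(1 - y)\<close>. As \<open>s \<noteq> \<plusminus> 1\<close>, a zero \<open>y\<close> has
  different signs at \<open>y\<close> and \<open>1 - y\<close>, which forces \<open>{y, 1 - y} = {(1 + s) / 2, (1 - s) / 2}\<close>; see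
  \<open>zeros_g_poly_iff\<close>.

  Now assume \<open>(1 + s) / 2 = u\<^sup>2\<close> while \<open>m = (1 - s) / 2\<close> is not a square, and let \<open>a = c\<^sup>2\<close> and
  \<open>1 - a = d\<^sup>2\<close>. Adjoin a square root \<open>V\<close> of \<open>m\<close>. The Frobenius map sends \<open>V\<close> to \<open>- V\<close>, so an element
  \<open>w = e + f V\<close> satisfies \<open>(w\<^sup>2)\<^sup>n = w w\<^sup>q = e\<^sup>2 - f\<^sup>2 m\<close>, its norm. The point is that both zeros of the
  quadratic factor belonging to \<open>a\<close>, and also their complements to 1, have visible square roots: with
  \<open>c\<^sup>2 + d\<^sup>2 = 1 = u\<^sup>2 + m\<close>, the element \<open>z = (d u + c V)\<^sup>2\<close> is such a zero, and
  \<open>1 - z = (c u - d V)\<^sup>2\<close>. Hence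
  \<open>z\<^sup>n + (1 - z)\<^sup>n = (d\<^sup>2 u\<^sup>2 - c\<^sup>2 m) + (c\<^sup>2 u\<^sup>2 - d\<^sup>2 m) = u\<^sup>2 - m = s\<close>.
  The factor has no zero in the base field, because \<open>z\<close> does not lie in it; so it is irreducible and
  divides the polynomial (\<open>quad_factor_properties\<close>). Since \<open>s \<noteq> 0\<close>, different \<open>a\<close> give different
  factors, and the product of all the factors, linear and quadratic, divides the polynomial.

  It remains to see that nothing is left over. The rational parametrization of the circle
  \<open>x\<^sup>2 + y\<^sup>2 = 1\<close> yields enough values \<open>a = x\<^sup>2\<close> for the degree of the product to reach that of
  \<open>y\<^sup>n + (1 - y)\<^sup>n - s\<close> (\<open>card_C_set_lower_bound\<close>, \<open>degree_g_poly\<close>); a lower bound suffices,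
  because divisibility provides the other inequality. The case distinction behind \<open>\<tau>\<close> reflects that
  for odd \<open>n\<close> the leading terms cancel and \<open>n = 1 / 2\<close> becomes the leading coefficient, whereas for
  even \<open>n\<close> they add up to 2.
\<close>

section \<open>Divisibility and zeros of polynomials\<close>

lemma pcompose_power: "(P ^ n) \<circ>\<^sub>p R = (P \<circ>\<^sub>p R) ^ n" for P R :: "'a::comm_semiring_1 poly"
  by (induction n) (simp_all add: pcompose_1 pcompose_mult)

lemma card_poly_zeros_le:
  fixes A :: "'a::idom set"
  assumes "P \<noteq> 0" "degree P \<le> k" "\<And>x. x \<in> A \<Longrightarrow> poly P x = 0"
  shows "card A \<le> k"
proof -
  have "card A \<le> card {x. poly P x = 0}"
    using assms by (intro card_mono poly_roots_finite) auto
  also have "\<dots> \<le> degree P"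
    by (rule card_poly_roots_bound[OF assms(1)])
  finally show ?thesis
    using assms(2) by simp
qed

lemma linear_factors_dvd:
  fixes P :: "'a::field poly"
  assumes "poly P x = 0" "poly P y = 0" "x \<noteq> y"
  shows "[:- x, 1:] * [:- y, 1:] dvd P"
proof -
  obtain H where H: "P = [:- x, 1:] * H"
    using assms(1) by (auto simp: poly_eq_0_iff_dvd elim: dvdE)
  then have "poly H y = 0"
    using assms(2,3) by simp
  then show ?thesis
    unfolding H by (simp only: poly_eq_0_iff_dvd mult_dvd_mono dvd_refl)
qed

text \<open>A proper factorization of a quadratic polynomial has a linear factor, and over a field a
  linear factor has a zero.\<close>
lemma irreducible_if_degree_2_no_zeros:
  fixes P :: "'a::field poly"
  assumes deg: "degree P = 2" and no_zeros: "\<And>x. poly P x \<noteq> 0"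
  shows "irreducible P"
proof (rule irreducibleI)
  show "P \<noteq> 0"
    using deg by auto
  show "\<not> P dvd 1"
    using deg by (auto simp: is_unit_iff_degree \<open>P \<noteq> 0\<close>)
  show "A dvd 1 \<or> B dvd 1" if P: "P = A * B" for A B
  proof (rule ccontr)
    assume nonunits: "\<not> (A dvd 1 \<or> B dvd 1)"
    have "A \<noteq> 0" "B \<noteq> 0"
      using P \<open>P \<noteq> 0\<close> by auto
    then have "degree A \<noteq> 0" "degree B \<noteq> 0" "degree A + degree B = 2"
      using nonunits deg by (auto simp: P degree_mult_eq is_unit_iff_degree)
    then have "degree A = 1"
      by simp
    then obtain b c where A: "A = [:c, b:]" "b \<noteq> 0"
      by (metis degree1_coeffs)
    then have "poly A (- c / b) = 0"
      by simp
    then show False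
      using no_zeros[of "- c / b"] by (simp add: P)
  qed
qed

lemma prime_elem_dvd_prodD:
  fixes f :: "'b \<Rightarrow> 'a::idom"
  assumes "prime_elem r" "finite A" "r dvd prod f A"
  shows "\<exists>a\<in>A. r dvd f a"
  using assms(2,3)
proof (induction A rule: finite_induct)
  case empty
  then show ?case
    using assms(1) by (simp add: prime_elem_def)
next
  case (insert a A)
  then show ?case
    using prime_elem_dvd_multD[OF assms(1), of "f a" "prod f A"] by auto
qed

text \<open>Pairwise non-dividing primes can be split off one after another: a prime that divides \<open>g\<close>
  but none of the primes split off so far divides the remaining cofactor.\<close>
lemma prod_dvd_if_prime_elems_dvd:
  fixes f :: "'b \<Rightarrow> 'a::idom"
  assumes "finite A" "\<And>a. a \<in> A \<Longrightarrow> prime_elem (f a)" "\<And>a. a \<in> A \<Longrightarrow> f a dvd g"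
    and "\<And>a b. a \<in> A \<Longrightarrow> b \<in> A \<Longrightarrow> f a dvd f b \<Longrightarrow> a = b"
  shows "prod f A dvd g"
  using assms
proof (induction A rule: finite_induct)
  case (insert a A)
  have "prod f A dvd g"
    by (rule insert.IH) (use insert.prems in blast)+
  then obtain h where h: "g = prod f A * h"
    by (elim dvdE)
  have prime: "prime_elem (f a)" and "f a dvd g"
    using insert.prems by blast+
  have "\<not> f a dvd prod f A"
  proof
    assume "f a dvd prod f A"
    then obtain b where "b \<in> A" "f a dvd f b"
      using prime_elem_dvd_prodD[OF prime insert.hyps(1)] by blast
    then show False
      using insert.prems(3)[of a b] insert.hyps(2) by blast
  qed
  then have "f a dvd h"
    using prime_elem_dvd_multD[OF prime] \<open>f a dvd g\<close> h by blast
  then show ?case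
    unfolding h prod.insert[OF insert.hyps] mult.commute[of "f a"]
    by (rule mult_dvd_mono[OF dvd_refl])
qed simp

text \<open>The comparison that turns divisibility into the explicit identity: once the degree of the
  multiple is bounded by that of the divisor, the cofactor is a constant, which the leading
  coefficients determine.\<close>
lemma eq_smult_if_monic_dvd:
  fixes M G :: "'a::field poly"
  assumes "M dvd G" "lead_coeff M = 1" "degree G \<le> degree M"
  shows "G = smult (lead_coeff G) M"
proof (cases "G = 0")
  case False
  obtain H where H: "G = M * H"
    using assms(1) by (elim dvdE)
  then have "M \<noteq> 0" "H \<noteq> 0"
    using False by auto
  then have "degree H = 0"
    using assms(3) by (simp add: H degree_mult_eq)
  then obtain c where c: "H = [:c:]"
    by (elim degree_eq_zeroE)
  then have "G = smult c M"
    by (simp add: H)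
  then show ?thesis
    using assms(2) by simp
qed simp

section \<open>Finite fields of odd order\<close>

text \<open>Adding 1 permutes the field, and so does not change the sum of all its elements.\<close>
lemma of_nat_CARD_eq_0: "(of_nat CARD('a) :: 'a::{field,finite}) = 0"
proof -
  have "(\<Sum>x\<in>(UNIV :: 'a set). x) = (\<Sum>x\<in>UNIV. x + 1)"
    by (rule sum.reindex_bij_witness[of _ "\<lambda>x. x + 1" "\<lambda>x. x - 1"]) auto
  then show ?thesis
    by (simp add: sum.distrib)
qed

lemma two_neq_0:
  assumes "odd CARD('a::{field,finite})"
  shows "(2 :: 'a) \<noteq> 0"
proof
  assume 2: "(2 :: 'a) = 0"
  from assms obtain j where "CARD('a) = 2 * j + 1"
    by (elim oddE)
  then have "(of_nat CARD('a) :: 'a) = 2 * of_nat j + 1"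
    by simp
  then show False
    using 2 of_nat_CARD_eq_0[where 'a = 'a] by simp
qed

text \<open>Multiplication by \<open>x\<close> permutes the nonzero elements, and so does not change their product.\<close>
lemma power_CARD_minus_1:
  fixes x :: "'a::{field,finite}"
  assumes "x \<noteq> 0"
  shows "x ^ (CARD('a) - 1) = 1"
proof -
  have "(\<Prod>y\<in>UNIV - {0}. x * y) = (\<Prod>y\<in>UNIV - {0}. y)"
    by (rule prod.reindex_bij_witness[of _ "\<lambda>y. y / x" "\<lambda>y. x * y"]) (use assms in auto)
  then have "x ^ (CARD('a) - 1) * (\<Prod>y\<in>UNIV - {0}. y) = (\<Prod>y\<in>UNIV - {0}. y)"
    by (simp add: prod.distrib)
  then show ?thesis
    by simp
qed

lemma power_CARD:
  fixes x :: "'a::{field,finite}"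
  shows "x ^ CARD('a) = x"
proof (cases "x = 0")
  case False
  have "x ^ Suc (CARD('a) - 1) = x"
    by (simp only: power_Suc power_CARD_minus_1[OF False] mult_1_right)
  then show ?thesis
    by (simp only: Suc_diff_1[OF zero_less_card_finite])
qed simp

text \<open>Counting along fibres serves twice below: for squaring, where it shows that there are many
  squares, and for a parametrization of the set over which the quadratic factors range.\<close>
lemma card_le_mult_card_fibres:
  assumes "finite B" "f ` A \<subseteq> B" "\<And>b. b \<in> B \<Longrightarrow> card {a \<in> A. f a = b} \<le> k"
  shows "card A \<le> k * card B"
proof -
  have "A = (\<Union>b\<in>B. {a \<in> A. f a = b})"
    using assms(2) by auto
  then have "card A \<le> (\<Sum>b\<in>B. card {a \<in> A. f a = b})"
    using card_UN_le[OF assms(1), of "\<lambda>b. {a \<in> A. f a = b}"] by simp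
  also have "\<dots> \<le> (\<Sum>b\<in>B. k)"
    by (intro sum_mono assms(3))
  finally show ?thesis
    by (simp add: mult.commute)
qed

text \<open>The \<open>h\<close>-th power with \<open>2 h = q - 1\<close> takes only the values \<open>\<plusminus> 1\<close> on nonzero elements, and the
  value 1 on squares. A nonsquare with value 1 would join the at least \<open>h\<close> nonzero squares as a further
  zero of \<open>X\<^sup>h - 1\<close>, which is too many.\<close>
lemma euler_criterion:
  fixes x :: "'a::{field,finite}"
  assumes odd: "odd CARD('a)"
  shows "x ^ ((CARD('a) - 1) div 2) = of_int (quad_char x)"
proof -
  define h where "h = (CARD('a) - 1) div 2"
  have card: "CARD('a) = 2 * h + 1"
    using odd unfolding h_def by presburger
  have "CARD('a) \<ge> card {0 :: 'a, 1}"
    by (rule card_mono) auto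
  then have "h > 0"
    using card by simp
  have fermat: "(y ^ 2) ^ h = 1" if "y \<noteq> 0" for y :: 'a
    using power_CARD_minus_1[OF that] card by (simp add: power_mult)
  have "x ^ h = - 1" if "x \<noteq> 0" and nonsquare: "\<nexists>y. x = y ^ 2"
  proof (rule ccontr)
    assume "x ^ h \<noteq> - 1"
    moreover have "(x ^ h) ^ 2 = 1"
      using fermat[OF \<open>x \<noteq> 0\<close>] by (simp add: mult.commute flip: power_mult)
    ultimately have "x ^ h = 1"
      using power2_eq_1_iff by auto
    define S where "S = (\<lambda>y. y ^ 2) ` (UNIV - {0 :: 'a})"
    have "card (insert x S) \<le> h"
    proof (rule card_poly_zeros_le)
      show "poly (monom 1 h - 1) z = 0" if "z \<in> insert x S" for z
        using that \<open>x ^ h = 1\<close> fermat by (auto simp: S_def poly_monom)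
      show "degree (monom 1 h - 1 :: 'a poly) \<le> h"
        by (rule degree_diff_le) (auto simp: degree_monom_eq)
      have "coeff (monom 1 h - 1 :: 'a poly) h = 1"
        using \<open>h > 0\<close> by simp
      then show "monom 1 h - 1 \<noteq> (0 :: 'a poly)"
        by force
    qed
    moreover have "x \<notin> S"
      using nonsquare by (auto simp: S_def)
    ultimately have "card S < h"
      by simp
    have "card (UNIV - {0 :: 'a}) \<le> 2 * card S"
    proof (rule card_le_mult_card_fibres[where f = "\<lambda>y. y ^ 2"])
      show "card {y \<in> UNIV - {0}. y ^ 2 = b} \<le> 2" for b :: 'a
        by (rule card_poly_zeros_le[of "[:- b, 0, 1:]"]) (auto simp: power2_eq_square)
    qed (auto simp: S_def)
    then show False
      using card \<open>card S < h\<close> by simp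
  qed
  moreover have "x ^ h = 1" if "x \<noteq> 0" "x = y ^ 2" for y
    using that fermat[of y] by simp
  moreover have "x ^ h = 0" if "x = 0"
    using that \<open>h > 0\<close> by simp
  ultimately have "x ^ h = of_int (quad_char x)"
    unfolding quad_char_def by (cases "x = 0"; cases "\<exists>y. x = y ^ 2") auto
  then show ?thesis
    by (simp only: h_def)
qed

text \<open>For \<open>q\<close> a power of a prime \<open>p\<close>, that prime is the characteristic, because \<open>p\<^sup>k = 0\<close> in the
  field.\<close>
lemma frobenius_add:
  fixes P Q :: "'a::{field,finite} poly"
  assumes "prime p" "CARD('a) = p ^ k"
  shows "(P + Q) ^ CARD('a) = P ^ CARD('a) + Q ^ CARD('a)"
proof -
  have "(of_nat p :: 'a) ^ k = 0"
    using of_nat_CARD_eq_0[where 'a = 'a] assms(2) by simp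
  then have "(of_nat p :: 'a) = 0"
    by simp
  then have "CHAR('a) dvd p"
    by (simp add: of_nat_eq_0_iff_char_dvd)
  moreover have "CHAR('a) \<noteq> 1"
    by simp
  ultimately have "CHAR('a) = p"
    using assms(1) by (auto simp: prime_nat_iff)
  then show ?thesis
    using assms by (intro freshmans_dream'[of _ k]) auto
qed

section \<open>The zeros of the polynomial\<close>

text \<open>Since \<open>n = (q - 1) / 2 + 1\<close>, Euler's criterion makes the polynomial piecewise linear as a
  function on the field.\<close>
lemma poly_g_poly:
  fixes s :: "'a::{field,finite}"
  assumes odd: "odd CARD('a)"
  shows "poly (g_poly s) y =
    y * of_int (quad_char y) + (1 - y) * of_int (quad_char (1 - y)) - s"
proof -
  have n: "(CARD('a) + 1) div 2 = Suc ((CARD('a) - 1) div 2)"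
    using odd by presburger
  have "poly (g_poly s) y = y ^ Suc ((CARD('a) - 1) div 2) + (1 - y) ^ Suc ((CARD('a) - 1) div 2) - s"
    unfolding g_poly_def Let_def n by (simp del: power_Suc)
  then show ?thesis
    by (simp only: power_Suc euler_criterion[OF odd])
qed

lemma quad_char_eq_1_D:
  assumes "quad_char x = 1"
  shows "\<exists>y. x = y ^ 2 \<and> y \<noteq> 0"
proof -
  have "x \<noteq> 0" and "\<exists>y. x = y ^ 2"
    using assms by (auto simp: quad_char_def split: if_splits)
  then obtain y where "x = y ^ 2"
    by blast
  with \<open>x \<noteq> 0\<close> have "x = y ^ 2 \<and> y \<noteq> 0"
    by auto
  then show ?thesis ..
qed

lemma quad_char_one: "quad_char (1 :: 'a::field) = 1"
proof -
  have "\<exists>y :: 'a. 1 = y ^ 2"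
    by (rule exI[of _ 1]) simp
  then show ?thesis
    by (simp add: quad_char_def)
qed

text \<open>If \<open>y\<close> and \<open>1 - y\<close> have the same character, the value of the polynomial at \<open>y\<close> is
  \<open>\<plusminus> 1 - s \<noteq> 0\<close>; if one of them is 0, the value is \<open>1 - s \<noteq> 0\<close>. Opposite characters leave
  \<open>2 y - 1 = \<plusminus> s\<close>. In either case the one of \<open>y\<close>, \<open>1 - y\<close> that is a square is \<open>(1 + s) / 2\<close>.\<close>
lemma zeros_g_poly_iff:
  fixes s :: "'a::{field,finite}"
  assumes odd: "odd CARD('a)" and s: "s \<notin> {0, 1, -1}"
  shows "poly (g_poly s) y = 0 \<longleftrightarrow>
    quad_char ((1 + s) / 2) = 1 \<and> quad_char ((1 - s) / 2) = -1 \<and>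
    (y = (1 + s) / 2 \<or> y = (1 - s) / 2)"
proof -
  have two: "(2 :: 'a) \<noteq> 0"
    by (rule two_neq_0[OF odd])
  define b where "b = (1 + s) / 2"
  define c where "c = (1 - s) / 2"
  have "2 * b = 1 + s" "2 * c = 1 - s"
    using two by (simp_all add: b_def c_def)
  then have "2 * (1 - b) = 2 * c" "2 * (1 - c) = 2 * b" "2 * (b - c) = 2 * s"
    by (simp_all add: algebra_simps)
  then have compl: "1 - b = c" "1 - c = b" and diff: "b - c = s"
    using two by (simp_all only: mult_cancel_left simp_thms)
  have "quad_char b = 1 \<and> quad_char c = -1 \<and> (y = b \<or> y = c)" if "poly (g_poly s) y = 0"
  proof -
    have eq: "y * of_int (quad_char y) + (1 - y) * of_int (quad_char (1 - y)) = s"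
      using that by (simp add: poly_g_poly[OF odd])
    have "y \<noteq> 0" "1 - y \<noteq> 0"
      using eq s by (auto simp: quad_char_one)
    then have "quad_char y = 1 \<or> quad_char y = -1" "quad_char (1 - y) = 1 \<or> quad_char (1 - y) = -1"
      by (simp_all add: quad_char_def)
    then consider "quad_char y = 1" "quad_char (1 - y) = 1"
      | "quad_char y = -1" "quad_char (1 - y) = -1"
      | "quad_char y = 1" "quad_char (1 - y) = -1"
      | "quad_char y = -1" "quad_char (1 - y) = 1"
      by blast
    then show ?thesis
    proof cases
      case 3
      then have "2 * y = 2 * b"
        using eq \<open>2 * b = 1 + s\<close> by (simp add: algebra_simps)
      then have "y = b"
        using two by (simp only: mult_cancel_left simp_thms)
      then show ?thesis
        using 3 compl by simp
    next
      case 4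
      then have "2 * y = 1 - s"
        using eq by (simp add: algebra_simps)
      then have "2 * y = 2 * c"
        by (simp only: \<open>2 * c = 1 - s\<close>)
      then have "y = c"
        using two by (simp only: mult_cancel_left simp_thms)
      then show ?thesis
        using 4 compl by simp
    qed (use eq s in auto)
  qed
  moreover have "poly (g_poly s) y = 0" if "quad_char b = 1" "quad_char c = -1" "y = b \<or> y = c"
    using that diff by (auto simp: poly_g_poly[OF odd] compl)
  ultimately show ?thesis
    unfolding b_def[symmetric] c_def[symmetric] by blast
qed

section \<open>The quadratic factors\<close>

text \<open>Congruences modulo \<open>V\<^sup>2 - m\<close>, for \<open>m\<close> not a square, play the role of computations in the
  quadratic extension field. There \<open>V\<^sup>q = V m\<^sup>h = - V\<close> with \<open>2 h = q - 1\<close>, so that the \<open>q\<close>-th power is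
  conjugation and the power with exponent \<open>q + 1\<close> is the norm.\<close>
lemma norm_cong:
  fixes m e f :: "'a::{field,finite}"
  assumes odd: "odd CARD('a)" and prime_power: "prime p" "CARD('a) = p ^ k"
    and m: "quad_char m = -1"
  shows "[[:e, f:] ^ (CARD('a) + 1) = [:e ^ 2 - f ^ 2 * m:]] (mod [:- m, 0, 1:])"
proof -
  let ?V = "[:0, 1:] :: 'a poly" and ?q = "CARD('a)"
  have V2: "[?V ^ 2 = [:m:]] (mod [:- m, 0, 1:])"
    by (simp add: cong_iff_dvd_diff power2_eq_square)
  have "?V ^ ?q = ?V * (?V ^ 2) ^ ((?q - 1) div 2)"
  proof -
    have "?q = Suc (2 * ((?q - 1) div 2))"
      using odd by presburger
    then show ?thesis
      by (metis power_Suc power_mult)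
  qed
  moreover have "[?V * (?V ^ 2) ^ ((?q - 1) div 2) = ?V * [:m:] ^ ((?q - 1) div 2)] (mod [:- m, 0, 1:])"
    by (intro cong_mult cong_pow V2 cong_refl)
  moreover have "[:m:] ^ ((?q - 1) div 2) = [:-1:]"
    by (simp only: poly_const_pow euler_criterion[OF odd] m of_int_minus of_int_1)
  ultimately have V: "[?V ^ ?q = - ?V] (mod [:- m, 0, 1:])"
    by simp
  have "[:e, f:] = [:e:] + [:f:] * ?V"
    by simp
  then have "[:e, f:] ^ ?q = [:e:] ^ ?q + [:f:] ^ ?q * ?V ^ ?q"
    by (simp only: frobenius_add[OF prime_power] power_mult_distrib)
  also have "\<dots> = [:e:] + [:f:] * ?V ^ ?q"
    by (simp add: poly_const_pow power_CARD)
  also have "[\<dots> = [:e:] + [:f:] * - ?V] (mod [:- m, 0, 1:])"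
    by (intro cong_add cong_mult V cong_refl)
  finally have conj: "[[:e, f:] ^ ?q = [:e, - f:]] (mod [:- m, 0, 1:])"
    by simp
  have "[[:e, f:] * [:e, f:] ^ ?q = [:e, f:] * [:e, - f:]] (mod [:- m, 0, 1:])"
    by (intro cong_mult conj cong_refl)
  also have "[:e, f:] * [:e, - f:] = [:e ^ 2:] - [:f ^ 2:] * ?V ^ 2"
    by (simp add: power2_eq_square)
  also have "[\<dots> = [:e ^ 2:] - [:f ^ 2:] * [:m:]] (mod [:- m, 0, 1:])"
    by (intro cong_diff cong_mult V2 cong_refl)
  also have "[:e ^ 2:] - [:f ^ 2:] * [:m:] = [:e ^ 2 - f ^ 2 * m:]"
    by simp
  finally show ?thesis
    by (simp only: Suc_eq_plus1[symmetric] power_Suc)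
qed

text \<open>The base here is \<open>(e + f V)\<^sup>2\<close>, reduced to a linear polynomial, and \<open>2 n = q + 1\<close>.\<close>
lemma half_norm_cong:
  fixes m e f :: "'a::{field,finite}"
  assumes odd: "odd CARD('a)" and prime_power: "prime p" "CARD('a) = p ^ k"
    and m: "quad_char m = -1"
  shows "[[:e ^ 2 + f ^ 2 * m, 2 * e * f:] ^ ((CARD('a) + 1) div 2) = [:e ^ 2 - f ^ 2 * m:]]
    (mod [:- m, 0, 1:])"
proof -
  let ?n = "(CARD('a) + 1) div 2"
  have "[:e, f:] ^ 2 - [:e ^ 2 + f ^ 2 * m, 2 * e * f:] = [:f ^ 2:] * [:- m, 0, 1:]"
    by (simp add: power2_eq_square)
  then have "[[:e, f:] ^ 2 = [:e ^ 2 + f ^ 2 * m, 2 * e * f:]] (mod [:- m, 0, 1:])"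
    unfolding cong_iff_dvd_diff by (simp only: dvd_triv_right)
  then have "[[:e ^ 2 + f ^ 2 * m, 2 * e * f:] ^ ?n = ([:e, f:] ^ 2) ^ ?n] (mod [:- m, 0, 1:])"
    by (rule cong_pow[OF cong_sym])
  also have "([:e, f:] ^ 2) ^ ?n = [:e, f:] ^ (CARD('a) + 1)"
  proof -
    have "2 * ?n = CARD('a) + 1"
      using odd by simp
    then show ?thesis
      by (simp only: flip: power_mult)
  qed
  finally show ?thesis
    using norm_cong[OF assms] by (rule cong_trans)
qed

text \<open>With \<open>A + B V\<close> denoting \<open>(d u + c V)\<^sup>2\<close> reduced modulo \<open>V\<^sup>2 - m\<close>, the quadratic factor is
  \<open>(y - A)\<^sup>2 - B\<^sup>2 m\<close>, the minimal polynomial of \<open>A + B V\<close>. A zero in the base field would make \<open>m\<close> a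
  square. Divisibility is shown after the substitution \<open>y = A + B V\<close>, which turns the factor into a
  multiple of the modulus \<open>V\<^sup>2 - m\<close>, and is then transported back.\<close>
lemma quad_factor_properties:
  fixes s a :: "'a::{field,finite}"
  assumes odd: "odd CARD('a)" and prime_power: "prime p" "CARD('a) = p ^ k"
    and plus: "quad_char ((1 + s) / 2) = 1" and minus: "quad_char ((1 - s) / 2) = -1"
    and a: "a \<in> C_set"
  shows "poly (quad_factor s a) x \<noteq> 0"
    and "irreducible (quad_factor s a)"
    and "quad_factor s a dvd g_poly s"
proof -
  have two: "(2 :: 'a) \<noteq> 0"
    by (rule two_neq_0[OF odd])
  define m where "m = (1 - s) / 2"
  from a have squares: "quad_char a = 1" "quad_char (1 - a) = 1"
    by (simp_all add: C_set_def)
  obtain c where c: "a = c ^ 2" "c \<noteq> 0"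
    using quad_char_eq_1_D[OF squares(1)] by blast
  obtain d where d: "1 - a = d ^ 2" "d \<noteq> 0"
    using quad_char_eq_1_D[OF squares(2)] by blast
  from plus obtain u where u: "(1 + s) / 2 = u ^ 2" "u \<noteq> 0"
    by (auto simp: quad_char_def split: if_splits)
  have m: "quad_char m = -1"
    using minus by (simp add: m_def)
  have "2 * u ^ 2 = 1 + s" "2 * m = 1 - s"
    using two by (simp_all add: m_def flip: u(1))
  then have "2 * s = 2 * (u ^ 2 - m)" "2 * (u ^ 2 + m) = 2 * 1"
    by (simp_all add: algebra_simps)
  then have s: "s = u ^ 2 - m" and um: "u ^ 2 + m = 1"
    using two by (simp_all only: mult_cancel_left simp_thms)
  have cd: "c ^ 2 + d ^ 2 = 1"
    using c d by (simp flip: c d)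
  define A where "A = (d * u) ^ 2 + c ^ 2 * m"
  define B where "B = 2 * (d * u) * c"
  have B: "B \<noteq> 0"
    using two c d u by (simp add: B_def)
  have lin: "2 * a * s - 1 - s = - 2 * A"
  proof -
    have "2 * a * s - 1 - s = 2 * c\<^sup>2 * (u\<^sup>2 - m) - (u\<^sup>2 + m) - (u\<^sup>2 - m)"
      using c um s by simp
    also have "\<dots> = 2 * c\<^sup>2 * (u\<^sup>2 - m) - 2 * (c\<^sup>2 + d\<^sup>2) * u\<^sup>2"
      by (simp add: cd)
    finally show ?thesis
      by (simp add: A_def power_mult_distrib algebra_simps)
  qed
  have const: "(2 * a - 1 - s) ^ 2 / 4 = A ^ 2 - B ^ 2 * m"
  proof -
    have "2 * a - 1 - s = 2 * c\<^sup>2 * (u\<^sup>2 + m) - (u\<^sup>2 + m) - (u\<^sup>2 - m)"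
      using c um s by simp
    also have "\<dots> = 2 * c\<^sup>2 * (u\<^sup>2 + m) - 2 * (c\<^sup>2 + d\<^sup>2) * u\<^sup>2"
      by (simp add: cd)
    also have "\<dots> = 2 * (c\<^sup>2 * m - (d * u)\<^sup>2)"
      by (simp add: power_mult_distrib algebra_simps)
    finally have "(2 * a - 1 - s) ^ 2 = 2 ^ 2 * (c\<^sup>2 * m - (d * u)\<^sup>2) ^ 2"
      by (simp only: power_mult_distrib)
    moreover have "(4 :: 'a) = 2 ^ 2"
      by simp
    moreover have "(2 :: 'a) ^ 2 \<noteq> 0"
      by (rule power_not_zero[OF two])
    ultimately have "(2 * a - 1 - s) ^ 2 / 4 = (c\<^sup>2 * m - (d * u)\<^sup>2) ^ 2"
      by (simp only: nonzero_mult_div_cancel_left simp_thms not_False_eq_True)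
    then show ?thesis
      by (simp add: A_def B_def power2_eq_square algebra_simps)
  qed
  have Q: "quad_factor s a = [:A ^ 2 - B ^ 2 * m, - 2 * A, 1:]"
    by (simp only: quad_factor_def const lin)
  show no_zeros: "poly (quad_factor s a) x \<noteq> 0" for x
  proof
    assume "poly (quad_factor s a) x = 0"
    then have "m * B ^ 2 = (x - A) ^ 2"
      by (simp add: Q power2_eq_square algebra_simps)
    then have "m = ((x - A) / B) ^ 2"
      using B by (simp add: field_simps)
    then show False
      using m by (auto simp: quad_char_def split: if_splits)
  qed
  show "irreducible (quad_factor s a)"
    by (rule irreducible_if_degree_2_no_zeros[OF _ no_zeros]) (simp add: quad_factor_def)
  let ?n = "(CARD('a) + 1) div 2"
  have one_minus: "[:1, -1:] \<circ>\<^sub>p [:A, B:] = [:(c * u) ^ 2 + (- d) ^ 2 * m, 2 * (c * u) * (- d):]"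
  proof -
    have "1 - A = (c\<^sup>2 + d\<^sup>2) * (u\<^sup>2 + m) - A"
      by (simp add: cd um)
    then show ?thesis
      by (simp add: pcompose_pCons A_def B_def power_mult_distrib algebra_simps)
  qed
  \<comment> \<open>The right-hand side above is \<open>(c u - d V)\<^sup>2\<close> reduced modulo \<open>V\<^sup>2 - m\<close>, so both powers below
    are norms.\<close>
  have g_comp: "g_poly s \<circ>\<^sub>p [:A, B:] =
      [:A, B:] ^ ?n + ([:1, -1:] \<circ>\<^sub>p [:A, B:]) ^ ?n - [:s:]"
    by (simp add: g_poly_def Let_def pcompose_add pcompose_diff pcompose_power pcompose_pCons)
  have "[[:A, B:] ^ ?n + ([:1, -1:] \<circ>\<^sub>p [:A, B:]) ^ ?n - [:s:] =
      [:(d * u) ^ 2 - c ^ 2 * m:] + [:(c * u) ^ 2 - (- d) ^ 2 * m:] - [:s:]] (mod [:- m, 0, 1:])"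
    unfolding one_minus unfolding A_def B_def
    by (intro cong_add cong_diff cong_refl half_norm_cong[OF odd prime_power m])
  also have "[:(d * u) ^ 2 - c ^ 2 * m:] + [:(c * u) ^ 2 - (- d) ^ 2 * m:] - [:s:] = 0"
  proof -
    have "s = (c\<^sup>2 + d\<^sup>2) * (u\<^sup>2 - m)"
      by (simp add: cd s)
    then show ?thesis
      by (simp add: power_mult_distrib algebra_simps)
  qed
  finally have "[:- m, 0, 1:] dvd g_poly s \<circ>\<^sub>p [:A, B:]"
    by (simp add: g_comp cong_0_iff)
  then obtain H where H: "g_poly s \<circ>\<^sub>p [:A, B:] = [:- m, 0, 1:] * H"
    by (elim dvdE)
  \<comment> \<open>The inverse of the substitution.\<close>
  let ?L = "[:- A / B, 1 / B:]"
  have "[:A, B:] \<circ>\<^sub>p ?L = [:0, 1:]"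
    using B by (simp add: pcompose_pCons)
  then have "g_poly s = (g_poly s \<circ>\<^sub>p [:A, B:]) \<circ>\<^sub>p ?L"
    by (simp flip: pcompose_assoc)
  then have "g_poly s = ([:- m, 0, 1:] \<circ>\<^sub>p ?L) * (H \<circ>\<^sub>p ?L)"
    by (simp only: H pcompose_mult)
  moreover have "[:- m, 0, 1:] \<circ>\<^sub>p ?L = smult (1 / B ^ 2) (quad_factor s a)"
    using B by (simp add: Q pcompose_pCons field_simps power2_eq_square)
  ultimately show "quad_factor s a dvd g_poly s"
    by (simp add: dvd_smult)
qed

section \<open>Comparing degrees\<close>

text \<open>The points of the circle \<open>x\<^sup>2 + y\<^sup>2 = 1\<close> with \<open>x y \<noteq> 0\<close> give the elements \<open>a = x\<^sup>2\<close> with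
  \<open>1 - a = y\<^sup>2\<close>. In the parametrization \<open>x = (1 - t\<^sup>2) / (1 + t\<^sup>2)\<close>, \<open>y = 2 t / (1 + t\<^sup>2)\<close> one has to avoid
  \<open>t = 0\<close>, \<open>t = \<plusminus> 1\<close> and \<open>t\<^sup>2 = - 1\<close>, where the last equation has two solutions if \<open>q mod 4 = 1\<close> and
  none otherwise. Each \<open>a\<close> comes from at most 4 values of \<open>t\<close>, the zeros of a quartic.\<close>
lemma card_C_set_lower_bound:
  assumes odd: "odd CARD('a::{field,finite})"
  shows "CARD('a) \<le> 4 * card (C_set :: 'a set) + (if CARD('a) mod 4 = 1 then 5 else 3)"
proof -
  have two: "(2 :: 'a) \<noteq> 0"
    by (rule two_neq_0[OF odd])
  define I where "I = {t :: 'a. t ^ 2 = - 1}"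
  define T where "T = UNIV - ({0, 1, -1} \<union> I)"
  define f where "f = (\<lambda>t :: 'a. ((1 - t ^ 2) / (1 + t ^ 2)) ^ 2)"
  have I: "card I \<le> (if CARD('a) mod 4 = 1 then 2 else 0)"
  proof (cases "CARD('a) mod 4 = 1")
    case True
    have "card I \<le> 2"
      by (rule card_poly_zeros_le[of "[:1, 0, 1:]"]) (auto simp: I_def power2_eq_square)
    then show ?thesis
      using True by simp
  next
    case False
    then obtain j where j: "CARD('a) - 1 = 2 * j" "odd j"
      using odd by (intro that[of "(CARD('a) - 1) div 2"]) presburger+
    have "t \<notin> I" for t
    proof
      assume "t \<in> I"
      then have t: "t ^ 2 = -1"
        by (simp add: I_def)
      then have "t ^ (CARD('a) - 1) = 1"
        by (intro power_CARD_minus_1) auto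
      then have "(- 1 :: 'a) = 1"
        using j by (simp add: power_mult t)
      then show False
        using two by (simp add: neg_eq_iff_add_eq_0)
    qed
    then have "I = {}"
      by blast
    then show ?thesis
      by simp
  qed
  have "card T \<le> 4 * card (C_set :: 'a set)"
  proof (rule card_le_mult_card_fibres[where f = f])
    show "f ` T \<subseteq> C_set"
    proof safe
      fix t assume "t \<in> T"
      then have t: "t \<noteq> 0" "1 - t ^ 2 \<noteq> 0" "1 + t ^ 2 \<noteq> 0"
        by (auto simp: T_def I_def power2_eq_1_iff eq_commute[of 1 "t\<^sup>2"] add_eq_0_iff)
      have "1 - f t = (2 * t / (1 + t ^ 2)) ^ 2"
        using t(3) by (simp add: f_def power_divide divide_simps) (simp add: power2_eq_square algebra_simps)
      moreover have "f t \<noteq> 0" "2 * t / (1 + t ^ 2) \<noteq> 0"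
        using t two by (simp_all add: f_def)
      ultimately show "f t \<in> C_set"
        unfolding C_set_def quad_char_def by (auto simp: f_def)
    qed
  next
    fix a :: 'a assume "a \<in> C_set"
    then have a: "1 - a \<noteq> 0"
      by (auto simp: C_set_def quad_char_def split: if_splits)
    show "card {t \<in> T. f t = a} \<le> 4"
    \<comment> \<open>The quartic is \<open>(1 - t\<^sup>2)\<^sup>2 - a (1 + t\<^sup>2)\<^sup>2\<close>.\<close>
    proof (rule card_poly_zeros_le)
      show "poly [:1 - a, 0, - 2 * (1 + a), 0, 1 - a:] t = 0" if "t \<in> {t \<in> T. f t = a}" for t
      proof -
        from that have "1 + t ^ 2 \<noteq> 0" "((1 - t ^ 2) / (1 + t ^ 2)) ^ 2 = a"
          by (auto simp: T_def I_def f_def add_eq_0_iff)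
        then have "(1 - t ^ 2) ^ 2 = a * (1 + t ^ 2) ^ 2"
          by (auto simp: power_divide field_simps)
        then show ?thesis
          by (simp add: power2_eq_square algebra_simps)
      qed
    qed (use a in auto)
  qed auto
  moreover have "card ({0, 1, -1} \<union> I) \<le> 3 + card I"
    by (rule order_trans[OF card_Un_le]) (simp add: card_insert_if)
  moreover have "card T = CARD('a) - card ({0, 1, -1} \<union> I)"
    unfolding T_def by (simp add: card_Diff_subset)
  ultimately show ?thesis
    using I by (auto split: if_splits)
qed

text \<open>The terms of degree \<open>n\<close> add up to \<open>1 + (- 1)\<^sup>n\<close>. If \<open>q mod 4 = 1\<close>, then \<open>n\<close> is odd, these terms
  cancel, and the coefficient of degree \<open>n - 1\<close> is \<open>n\<close>, which is \<open>1 / 2\<close> in the field because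
  \<open>2 n = q + 1\<close>. Otherwise \<open>n\<close> is even and the leading coefficient is 2.\<close>
lemma degree_g_poly:
  fixes s :: "'a::{field,finite}"
  assumes odd: "odd CARD('a)"
  shows "degree (g_poly s) = (if CARD('a) mod 4 = 1 then (CARD('a) - 1) div 2 else (CARD('a) + 1) div 2)"
      (is "_ = ?N")
    and "lead_coeff (g_poly s) = of_nat (tau CARD('a)) ^ 2 / 2"
proof -
  define n where "n = (CARD('a) + 1) div 2"
  have two: "(2 :: 'a) \<noteq> 0"
    by (rule two_neq_0[OF odd])
  have "CARD('a) \<ge> card {0 :: 'a, 1}"
    by (rule card_mono) auto
  then have "CARD('a) \<noteq> 1"
    by simp
  have coeff: "coeff (g_poly s) i =
      (if i = n then 1 else 0) + of_nat (n choose i) * (- 1) ^ i - (if i = 0 then s else 0)" for i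
  proof -
    have "[:0, 1:] ^ n = monom (1 :: 'a) n"
      by (simp add: monom_altdef)
    moreover have "coeff ([:1, -1:] ^ n) i = (of_nat (n choose i) * (- 1) ^ i :: 'a)"
    proof (cases "i \<le> n")
      case False
      then show ?thesis
        by (simp add: coeff_eq_0 degree_linear_power binomial_eq_0)
    qed (simp add: coeff_linear_poly_power)
    ultimately show ?thesis
      unfolding g_poly_def Let_def n_def[symmetric]
      by (simp add: coeff_pCons split: nat.splits)
  qed
  have mod4: thesis
    if "CARD('a) mod 4 = 1" "\<And>j. \<lbrakk>CARD('a) = 2 * j + 1; n = Suc j; even j\<rbrakk> \<Longrightarrow> thesis" for thesis
  proof (rule that(2))
    show "CARD('a) = 2 * (2 * (CARD('a) div 4)) + 1"
      using mult_div_mod_eq[of 4 "CARD('a)"] that(1) by simp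
    then show "n = Suc (2 * (CARD('a) div 4))"
      by (simp add: n_def)
  qed simp
  have half: "(of_nat n :: 'a) = 1 / 2"
  proof -
    have "of_nat (2 * n) = (of_nat (CARD('a) + 1) :: 'a)"
      using odd by (simp add: n_def)
    then have "2 * of_nat n = (1 :: 'a)"
      using of_nat_CARD_eq_0[where 'a = 'a] by simp
    then show ?thesis
      using two by (simp add: field_simps)
  qed
  have top: "coeff (g_poly s) ?N = of_nat (tau CARD('a)) ^ 2 / 2"
  proof (cases "CARD('a) mod 4 = 1")
    case True
    obtain j where j: "CARD('a) = 2 * j + 1" "n = Suc j" "even j"
      by (rule mod4[OF True])
    have "j \<noteq> 0" "?N = j"
      using j True \<open>CARD('a) \<noteq> 1\<close> by simp_all
    have "of_nat (n choose j) = (1 / 2 :: 'a)"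
      using half unfolding j(2) binomial_Suc_n .
    then show ?thesis
      unfolding \<open>?N = j\<close> coeff using True j(2,3) \<open>j \<noteq> 0\<close> by (simp add: tau_def)
  next
    case False
    then have "even n" "n \<noteq> 0" "?N = n"
      using odd unfolding n_def by presburger+
    then show ?thesis
      using False two by (simp add: coeff tau_def power2_eq_square)
  qed
  have "degree (g_poly s) \<le> ?N"
  proof (rule degree_le, safe)
    fix i assume i: "?N < i"
    show "coeff (g_poly s) i = 0"
    proof (cases "i > n")
      case True
      then show ?thesis
        by (simp add: coeff binomial_eq_0)
    next
      case False
      have mod: "CARD('a) mod 4 = 1"
        using False i by (auto simp: n_def split: if_splits)
      obtain j where j: "CARD('a) = 2 * j + 1" "n = Suc j" "even j"
        by (rule mod4[OF mod])
      then have "i = Suc j"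
        using i False mod by simp
      then show ?thesis
        unfolding coeff using j(2,3) by simp
    qed
  qed
  moreover have "(of_nat (tau CARD('a)) :: 'a) ^ 2 / 2 \<noteq> 0"
    using two by (auto simp: tau_def)
  ultimately show deg: "degree (g_poly s) = ?N"
    using le_degree[of "g_poly s" ?N] unfolding top by (intro order_antisym)
  show "lead_coeff (g_poly s) = of_nat (tau CARD('a)) ^ 2 / 2"
    unfolding deg by (rule top)
qed

text \<open>The quadratic factors are distinct because \<open>s \<noteq> 0\<close> makes their linear coefficients
  \<open>2 a s - 1 - s\<close> distinct. They have no zeros, so both zeros of the polynomial are left to the
  cofactor of their product. The degree count does the rest.\<close>
lemma g_poly_factorization:
  fixes s :: "'a::{field,finite}"
  assumes odd: "odd CARD('a)" and prime_power: "prime p" "CARD('a) = p ^ k"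
    and s: "s \<notin> {0, 1, -1}"
    and plus: "quad_char ((1 + s) / 2) = 1" and minus: "quad_char ((1 - s) / 2) = -1"
  shows "g_poly s = smult (of_nat (tau CARD('a)) ^ 2 / 2)
    ([:- ((1 + s) / 2), 1:] * [:- ((1 - s) / 2), 1:] * (\<Prod>a\<in>C_set. quad_factor s a))"
    (is "_ = smult _ (?L * ?P)")
proof -
  have two: "(2 :: 'a) \<noteq> 0"
    by (rule two_neq_0[OF odd])
  note factor = quad_factor_properties[OF odd prime_power plus minus]
  have monic: "lead_coeff (quad_factor s a) = 1" and deg: "degree (quad_factor s a) = 2" for a
    by (simp_all add: quad_factor_def)
  have nz: "quad_factor s a \<noteq> 0" for a
    by (simp add: quad_factor_def)
  have "?P dvd g_poly s"
  proof (rule prod_dvd_if_prime_elems_dvd)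
    fix a b :: 'a assume "quad_factor s a dvd quad_factor s b"
    from eq_smult_if_monic_dvd[OF this monic] have "quad_factor s b = quad_factor s a"
      unfolding monic unfolding deg by simp
    then have "coeff (quad_factor s a) 1 = coeff (quad_factor s b) 1"
      by simp
    then have "2 * a * s = 2 * b * s"
      by (simp add: quad_factor_def)
    then show "a = b"
      using s two by simp
  qed (use factor in \<open>auto intro: field_poly_irreducible_imp_prime\<close>)
  then obtain H where H: "g_poly s = ?P * H"
    by (elim dvdE)
  have "poly ?P x \<noteq> 0" for x
    using factor(1) by (simp add: poly_prod)
  moreover have "poly (g_poly s) ((1 + s) / 2) = 0" "poly (g_poly s) ((1 - s) / 2) = 0"
    using zeros_g_poly_iff[OF odd s] plus minus by auto
  ultimately have "poly H ((1 + s) / 2) = 0" "poly H ((1 - s) / 2) = 0"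
    by (auto simp: H)
  moreover have "(1 + s) / 2 \<noteq> (1 - s) / 2"
  proof
    assume "(1 + s) / 2 = (1 - s) / 2"
    then have "quad_char ((1 + s) / 2) = quad_char ((1 - s) / 2)"
      by (rule arg_cong)
    then show False
      unfolding plus minus by simp
  qed
  ultimately have "?L dvd H"
    by (intro linear_factors_dvd)
  then have dvd: "?L * ?P dvd g_poly s"
    by (simp only: H mult.commute[of ?L] mult_dvd_mono dvd_refl)
  have "?L \<noteq> 0" "?P \<noteq> 0"
    by (simp_all add: nz)
  then have "degree (?L * ?P) = degree ?L + degree ?P"
    by (rule degree_mult_eq)
  also have "degree ?L = 2"
    by simp
  also have "degree ?P = 2 * card (C_set :: 'a set)"
    by (simp add: degree_prod_eq_sum_degree nz deg)
  finally have "degree (?L * ?P) = 2 + 2 * card (C_set :: 'a set)" .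
  then have "degree (g_poly s) \<le> degree (?L * ?P)"
    using card_C_set_lower_bound[OF odd] odd by (auto simp: degree_g_poly(1)[OF odd] split: if_splits)
  moreover have "lead_coeff (?L * ?P) = 1"
    by (simp only: lead_coeff_mult lead_coeff_prod monic) simp
  ultimately show ?thesis
    using eq_smult_if_monic_dvd[OF dvd] by (simp only: degree_g_poly(2)[OF odd])
qed

theorem theorem2p1:
  fixes s :: "'a::{field,finite}" and p k q :: nat
  assumes "prime p" and "odd p" and "k \<ge> 1" and "q = p ^ k" and "CARD('a) = q"
    and "s \<notin> {0, 1, -1}"
  shows "((\<exists>y. poly (g_poly s) y = 0) \<longleftrightarrow>
            quad_char ((1 + s) / 2) = 1 \<and> quad_char ((1 - s) / 2) = -1) \<and>
         (quad_char ((1 + s) / 2) = 1 \<and> quad_char ((1 - s) / 2) = -1 \<longrightarrow>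
            {y. poly (g_poly s) y = 0} = {(1 + s) / 2, (1 - s) / 2} \<and>
            g_poly s = smult (of_nat (tau q) ^ 2 / 2)
              ([:- ((1 + s) / 2), 1:] * [:- ((1 - s) / 2), 1:] * (\<Prod>a\<in>C_set. quad_factor s a)) \<and>
            irreducible [:- ((1 + s) / 2), 1:] \<and>
            irreducible [:- ((1 - s) / 2), 1:] \<and>
            (\<forall>a\<in>C_set. irreducible (quad_factor s a)))"
proof -
  have card: "CARD('a) = p ^ k"
    by (simp only: assms(4,5))
  then have odd: "odd CARD('a)"
    using assms(2) by simp
  note zeros = zeros_g_poly_iff[OF odd assms(6)]
  show ?thesis
  proof (intro conjI impI)
    show "(\<exists>y. poly (g_poly s) y = 0) \<longleftrightarrow>
        quad_char ((1 + s) / 2) = 1 \<and> quad_char ((1 - s) / 2) = -1"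
      unfolding zeros by blast
  next
    assume "quad_char ((1 + s) / 2) = 1 \<and> quad_char ((1 - s) / 2) = -1"
    then have cond: "quad_char ((1 + s) / 2) = 1" "quad_char ((1 - s) / 2) = -1"
      by simp_all
    show "{y. poly (g_poly s) y = 0} = {(1 + s) / 2, (1 - s) / 2}"
      unfolding zeros using cond by blast
    show "g_poly s = smult (of_nat (tau q) ^ 2 / 2)
        ([:- ((1 + s) / 2), 1:] * [:- ((1 - s) / 2), 1:] * (\<Prod>a\<in>C_set. quad_factor s a))"
      using g_poly_factorization[OF odd assms(1) card assms(6) cond] by (simp only: assms(5))
    show "irreducible [:- ((1 + s) / 2), 1:]" "irreducible [:- ((1 - s) / 2), 1:]"
      by (rule irreducible_linear_field_poly; simp)+
    show "\<forall>a\<in>C_set. irreducible (quad_factor s a)"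
      using quad_factor_properties(2)[OF odd assms(1) card cond] by blast
  qed
qed

end
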